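(* Let $X$ be a Lindelöf space. If Player I has a winning strategy in the game $G_1(\mathcal{O},\mathcal{H})$ played on $X$, then $S_1(\mathcal{O},\mathcal{H})$ does not hold for $X$.
   Context: $\mathcal{O}$ denotes the set of all open covers of the space $(X,\tau)$, and $\mathcal{H}=\{R\in(\tau\setminus\{\emptyset\})^{\omega}:|\bigcap R|\geq 2\}$. The selection principle $S_1(\mathcal{O},\mathcal{H})$ is the statement: given any sequence $(\mathcal{C}_n)_{n\in\omega}$ of elements of $\mathcal{O}$, for each $n\in\omega$ there is a $C_n\in\mathcal{C}_n$ such that $|\bigcap_{n\in\omega}C_n|\geq 2$. The game $G_1(\mathcal{O},\mathcal{H})$ on $X$: in the $n$-th inning ($n\in\omega$) Player I plays some $\mathcal{C}_n\in\mathcal{O}$ and then Player II chooses some $C_n\in\mathcal{C}_n$. At the end, Player II wins if $|\bigcap_{n\in\omega}C_n|\geq 2$; otherwise Player I wins. *)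

theory Defs
  imports "HOL-Analysis.Lindelof_Spaces" "HOL-Library.Equipollence"
begin

definition open_covers :: "'a topology \<Rightarrow> 'a set set set"
  where "open_covers X = {\<C>. (\<forall>U\<in>\<C>. openin X U) \<and> \<Union>\<C> = topspace X}"

(* "At least two elements" is cardinal comparison rather than a condition on card,
   since card of an infinite set is 0. *)
definition fat_sequences :: "'a topology \<Rightarrow> (nat \<Rightarrow> 'a set) set"
  where "fat_sequences X =
    {R. (\<forall>n. openin X (R n) \<and> R n \<noteq> {}) \<and> {..<2::nat} \<lesssim> (\<Inter>n. R n)}"

(* The target family consists of sequences, not of sets, so selections are taken
   as indexed sequences. *)
definition S1 :: "'b set set \<Rightarrow> (nat \<Rightarrow> 'b) set \<Rightarrow> bool"
  where "S1 \<A> \<B> \<longleftrightarrow>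
    (\<forall>\<C>. (\<forall>n. \<C> n \<in> \<A>) \<longrightarrow> (\<exists>c. (\<forall>n. c n \<in> \<C> n) \<and> c \<in> \<B>))"

(* A strategy for Player I in the game G_1 maps the finite sequence of Player II's
   moves made so far to Player I's next move; it has to be legal only at positions
   reachable when Player I follows it. *)
definition G1_position :: "('b list \<Rightarrow> 'b set) \<Rightarrow> 'b list \<Rightarrow> bool"
  where "G1_position \<sigma> s \<longleftrightarrow> (\<forall>k<length s. s ! k \<in> \<sigma> (take k s))"

definition G1_strategy_I :: "'b set set \<Rightarrow> ('b list \<Rightarrow> 'b set) \<Rightarrow> bool"
  where "G1_strategy_I \<A> \<sigma> \<longleftrightarrow> (\<forall>s. G1_position \<sigma> s \<longrightarrow> \<sigma> s \<in> \<A>)"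

(* Player II wins a run iff the sequence c of her moves belongs to \<B>. *)
definition G1_winning_strategy_I ::
    "'b set set \<Rightarrow> (nat \<Rightarrow> 'b) set \<Rightarrow> ('b list \<Rightarrow> 'b set) \<Rightarrow> bool"
  where "G1_winning_strategy_I \<A> \<B> \<sigma> \<longleftrightarrow> G1_strategy_I \<A> \<sigma> \<and>
    (\<forall>c. (\<forall>n. c n \<in> \<sigma> (map c [0..<n])) \<longrightarrow> c \<notin> \<B>)"

(* For sequences of open sets the nonemptiness clause in the target family is redundant,
   so the winning condition is just that the intersection has at least two points. *)
lemma fat_sequences_iff:
  assumes "\<And>n. c n \<in> \<C> n" and "\<And>n. \<C> n \<in> open_covers X"
  shows "c \<in> fat_sequences X \<longleftrightarrow> {..<2::nat} \<lesssim> (\<Inter>n. c n)"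
proof -
  have "c n \<noteq> {}" if "{..<2::nat} \<lesssim> (\<Inter>n. c n)" for n
  proof
    assume "c n = {}"
    then have "(\<Inter>n. c n) = {}" by blast
    with that have "{..<2::nat} = {}" by (simp only: lepoll_empty_iff_empty)
    then show False by (simp add: lessThan_empty_iff)
  qed
  moreover have "openin X (c n)" for n
    using assms unfolding open_covers_def by blast
  ultimately show ?thesis unfolding fat_sequences_def by blast
qed

end

theory Submission
  imports Defs
begin

text \<open>
  In a Lindelof space Player I may thin out every cover in a winning strategy to a countable
  subcover: this only removes options of Player II, so the strategy remains winning. Against the
  thinned strategy there are only countably many finite positions, so the covers that Player I might
  ever play form a single sequence of open covers. Suppose that \<open>S1\<close> held. Apply it
  to that sequence: it picks one member of the cover at every position, all of them
  sharing two common points. These picks are a strategy for Player II, and the run in which she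
  follows it uses only some of the picks, hence its intersection still contains both points and
  she wins, a contradiction.

  The game-theoretic half of the argument, \<open>S1_imp_no_countable_winning_strategy_I\<close>, works
  for every target family that is closed under passing to a sequence with a smaller range.
\<close>

lemma G1_position_Nil: "G1_position \<sigma> []"
  by (simp add: G1_position_def)

lemma G1_position_snoc:
  "G1_position \<sigma> (s @ [x]) \<longleftrightarrow> G1_position \<sigma> s \<and> x \<in> \<sigma> s"
  by (auto simp: G1_position_def nth_append less_Suc_eq)

lemma G1_position_mono:
  assumes "\<And>s. \<tau> s \<subseteq> \<sigma> s" and "G1_position \<tau> s"
  shows "G1_position \<sigma> s"
  using assms unfolding G1_position_def by blast

lemma countable_G1_positions:
  assumes "\<And>s. G1_position \<tau> s \<Longrightarrow> countable (\<tau> s)"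
  shows "countable {s. G1_position \<tau> s}"
proof -
  have level: "countable {s. G1_position \<tau> s \<and> length s = n}" for n
  proof (induction n)
    case 0
    have "{s. G1_position \<tau> s \<and> length s = 0} \<subseteq> {[]}" by auto
    then show ?case by (rule countable_subset) simp
  next
    case (Suc n)
    let ?P = "{s. G1_position \<tau> s \<and> length s = n}"
    have "{s. G1_position \<tau> s \<and> length s = Suc n} \<subseteq> (\<Union>s\<in>?P. (\<lambda>x. s @ [x]) ` \<tau> s)"
    proof
      fix t assume t: "t \<in> {s. G1_position \<tau> s \<and> length s = Suc n}"
      then obtain s x where "t = s @ [x]" by (cases t rule: rev_cases) auto
      with t show "t \<in> (\<Union>s\<in>?P. (\<lambda>x. s @ [x]) ` \<tau> s)"
        by (auto simp: G1_position_snoc)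
    qed
    moreover have "countable (\<Union>s\<in>?P. (\<lambda>x. s @ [x]) ` \<tau> s)"
      using Suc.IH assms by (intro countable_UN countable_image) auto
    ultimately show ?case by (rule countable_subset)
  qed
  have "{s. G1_position \<tau> s} = (\<Union>n. {s. G1_position \<tau> s \<and> length s = n})" by auto
  then show ?thesis using level by simp
qed

text \<open>
  The selection principle, applied to an enumeration of Player I's moves at all positions, yields
  a reply for Player II to every position. Her run sees only the selections along one branch, in
  the order of the branch and not of the enumeration, which is why the target family has to be
  closed under shrinking the range.
\<close>

lemma S1_imp_no_countable_winning_strategy_I:
  assumes S1: "S1 \<A> \<B>"
    and closed: "\<And>c d. c \<in> \<B> \<Longrightarrow> range d \<subseteq> range c \<Longrightarrow> d \<in> \<B>"
    and countable: "\<And>s. G1_position \<tau> s \<Longrightarrow> countable (\<tau> s)"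
  shows "\<not> G1_winning_strategy_I \<A> \<B> \<tau>"
proof
  assume win: "G1_winning_strategy_I \<A> \<B> \<tau>"
  let ?P = "{s. G1_position \<tau> s}"
  define e where "e = from_nat_into ?P"
  have P: "countable ?P" "?P \<noteq> {}"
    using countable_G1_positions [OF countable] G1_position_Nil by auto
  have legal: "\<tau> s \<in> \<A>" if "G1_position \<tau> s" for s
    using win that unfolding G1_winning_strategy_I_def G1_strategy_I_def by blast
  have "\<forall>n. \<tau> (e n) \<in> \<A>"
    using legal from_nat_into [OF P(2)] unfolding e_def by blast
  then have "\<exists>c. (\<forall>n. c n \<in> \<tau> (e n)) \<and> c \<in> \<B>"
    using S1 [unfolded S1_def, rule_format, of "\<lambda>n. \<tau> (e n)"] by simp
  then obtain c where c: "\<And>n. c n \<in> \<tau> (e n)" "c \<in> \<B>"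
    by blast
  define pick where "pick s = c (to_nat_on ?P s)" for s
  have pick: "pick s \<in> \<tau> s" if "G1_position \<tau> s" for s
    using c(1) [of "to_nat_on ?P s"] P(1) that unfolding pick_def e_def by simp
  define L where "L = rec_nat [] (\<lambda>_ s. s @ [pick s])"
  have L: "L 0 = []" "L (Suc n) = L n @ [pick (L n)]" for n
    by (simp_all add: L_def)
  define d where "d n = pick (L n)" for n
  have history: "map d [0..<n] = L n" for n
    by (induction n) (simp_all add: L d_def)
  have position: "G1_position \<tau> (L n)" for n
    by (induction n) (simp_all add: L G1_position_Nil G1_position_snoc pick)
  have "d n \<in> \<tau> (map d [0..<n])" for n
    unfolding history d_def by (rule pick [OF position])
  then have "d \<notin> \<B>"
    using win unfolding G1_winning_strategy_I_def by blast
  moreover have "range d \<subseteq> range c"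
    by (auto simp: d_def pick_def)
  ultimately show False using closed c(2) by blast
qed

text \<open>Every run against the smaller strategy is also a run against the larger one.\<close>

lemma G1_winning_strategy_I_thin:
  assumes win: "G1_winning_strategy_I \<A> \<B> \<sigma>"
    and sub: "\<And>s. \<tau> s \<subseteq> \<sigma> s"
    and legal: "\<And>s. \<sigma> s \<in> \<A> \<Longrightarrow> \<tau> s \<in> \<A>"
  shows "G1_winning_strategy_I \<A> \<B> \<tau>"
  unfolding G1_winning_strategy_I_def G1_strategy_I_def
proof (intro conjI allI impI)
  fix s assume "G1_position \<tau> s"
  then have "G1_position \<sigma> s" by (rule G1_position_mono [OF sub])
  then show "\<tau> s \<in> \<A>"
    using win legal unfolding G1_winning_strategy_I_def G1_strategy_I_def by blast
next
  fix c assume "\<forall>n. c n \<in> \<tau> (map c [0..<n])"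
  then show "c \<notin> \<B>"
    using win sub unfolding G1_winning_strategy_I_def by blast
qed

lemma Lindelof_space_countable_subcover:
  assumes "Lindelof_space X" and "\<C> \<in> open_covers X"
  obtains \<D> where "countable \<D>" "\<D> \<subseteq> \<C>" "\<D> \<in> open_covers X"
proof -
  have \<C>: "\<forall>U\<in>\<C>. openin X U" "\<Union>\<C> = topspace X"
    using assms(2) by (simp_all add: open_covers_def)
  with assms(1) have "\<exists>\<D>. countable \<D> \<and> \<D> \<subseteq> \<C> \<and> \<Union>\<D> = topspace X"
    by (simp add: Lindelof_space_def)
  then obtain \<D> where \<D>: "countable \<D>" "\<D> \<subseteq> \<C>" "\<Union>\<D> = topspace X"
    by blast
  moreover have "\<D> \<in> open_covers X"
    using \<C>(1) \<D>(2,3) by (auto simp: open_covers_def)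
  ultimately show thesis using that by blast
qed

lemma fat_sequences_range_mono:
  assumes "c \<in> fat_sequences X" and "range d \<subseteq> range c"
  shows "d \<in> fat_sequences X"
proof -
  have c: "openin X (c n)" "c n \<noteq> {}" "{..<2::nat} \<lesssim> (\<Inter>n. c n)" for n
    using assms(1) by (simp_all add: fat_sequences_def)
  have "openin X (d n) \<and> d n \<noteq> {}" for n
  proof -
    obtain m where "d n = c m" using assms(2) by blast
    then show ?thesis using c by simp
  qed
  moreover have "{..<2::nat} \<lesssim> (\<Inter>n. d n)"
    using c(3) subset_imp_lepoll [OF Inter_anti_mono [OF assms(2)]] by (rule lepoll_trans)
  ultimately show ?thesis by (simp add: fat_sequences_def)
qed

theorem proposition2p2:
  fixes X :: "'a topology"
  assumes "Lindelof_space X"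
    and "\<exists>\<sigma>. G1_winning_strategy_I (open_covers X) (fat_sequences X) \<sigma>"
  shows "\<not> S1 (open_covers X) (fat_sequences X)"
proof
  assume S1: "S1 (open_covers X) (fat_sequences X)"
  obtain \<sigma> where \<sigma>: "G1_winning_strategy_I (open_covers X) (fat_sequences X) \<sigma>"
    using assms(2) by blast
  \<comment> \<open>At positions that cannot arise against \<open>\<sigma>\<close>, where \<open>\<sigma> s\<close> need not be a cover,
      \<open>\<tau> s = \<sigma> s\<close> is a possible choice; it keeps \<open>\<tau> s \<subseteq> \<sigma> s\<close> unconditional.\<close>
  have "\<exists>\<D> \<subseteq> \<sigma> s. \<sigma> s \<in> open_covers X \<longrightarrow> countable \<D> \<and> \<D> \<in> open_covers X" for s
  proof (cases "\<sigma> s \<in> open_covers X")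
    case True
    then show ?thesis by (rule Lindelof_space_countable_subcover [OF assms(1)]) blast
  qed blast
  then obtain \<tau> where sub: "\<And>s. \<tau> s \<subseteq> \<sigma> s"
    and thin: "\<And>s. \<sigma> s \<in> open_covers X \<Longrightarrow> countable (\<tau> s) \<and> \<tau> s \<in> open_covers X"
    by metis
  have "countable (\<tau> s)" if "G1_position \<tau> s" for s
    using G1_position_mono [OF sub that] \<sigma> thin
    unfolding G1_winning_strategy_I_def G1_strategy_I_def by blast
  with S1 fat_sequences_range_mono
  have "\<not> G1_winning_strategy_I (open_covers X) (fat_sequences X) \<tau>"
    by (rule S1_imp_no_countable_winning_strategy_I)
  moreover have "G1_winning_strategy_I (open_covers X) (fat_sequences X) \<tau>"
    by (rule G1_winning_strategy_I_thin [OF \<sigma> sub]) (rule conjunct2 [OF thin])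
  ultimately show False by contradiction
qed

end
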